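(* Let $L$ be any normal modal logic with the universal modality such that ${\sf K}_u \subseteq L \subseteq {\sf K4}_u$. Then the unification problem for $L$ is undecidable: there is no algorithm that decides, given an $\mathcal{L}$-formula $\varphi$, whether there exists a substitution $\sigma$ with $\sigma(\varphi)\in L$.
   Context: $\mathcal{L}$ is the propositional language with infinitely many propositional variables $p_0,p_1,\dots$, Boolean connectives $\wedge,\neg$ (and derived $\vee,\to,\leftrightarrow,\bot,\top$), and two unary modal operators $\Box$ and $\forall$, with duals $\Diamond=\neg\Box\neg$ and $\exists=\neg\forall\neg$. A normal modal logic with the universal modality is a set of $\mathcal{L}$-formulas containing all propositional tautologies and the axioms $\Box(p\to q)\to(\Box p\to\Box q)$, $\forall(p\to q)\to(\forall p\to\forall q)$, $\forall p\to p$, $\forall p\to\forall\forall p$, $p\to\forall\exists p$, $\forall p\to\Box p$, and closed under modus ponens, the necessitation rules $\varphi/\Box\varphi$ and $\varphi/\forall\varphi$, and uniform substitution. ${\sf K}_u$ is the smallest such logic; ${\sf K4}_u$ is the smallest such logic containing $\Box p\to\Box\Box p$. Semantically, ${\sf K}_u$ is the set of formulas valid in all frames $(W,R)$ and ${\sf K4}_u$ the set of formulas valid in all transitive frames, where $\Box$ is interpreted via $R$ and $\forall$ quantifies over all of $W$. A substitution is a map $\sigma$ from propositional variables to $\mathcal{L}$-formulas, extended homomorphically to all formulas. *)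

theory Defs
  imports Main "HOL-Library.Nat_Bijection"
begin

datatype fm = Var nat | Neg fm | Conj fm fm | Box fm | Univ fm

definition Disj :: "fm \<Rightarrow> fm \<Rightarrow> fm" where "Disj a b = Neg (Conj (Neg a) (Neg b))"
definition Imp :: "fm \<Rightarrow> fm \<Rightarrow> fm" where "Imp a b = Neg (Conj a (Neg b))"
definition Iff :: "fm \<Rightarrow> fm \<Rightarrow> fm" where "Iff a b = Conj (Imp a b) (Imp b a)"
definition Bot :: fm where "Bot = Conj (Var 0) (Neg (Var 0))"
definition Top :: fm where "Top = Neg Bot"
definition Dia :: "fm \<Rightarrow> fm" where "Dia a = Neg (Box (Neg a))"
definition Ex :: "fm \<Rightarrow> fm" where "Ex a = Neg (Univ (Neg a))"

primrec subst :: "(nat \<Rightarrow> fm) \<Rightarrow> fm \<Rightarrow> fm" where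
  "subst s (Var n) = s n"
| "subst s (Neg a) = Neg (subst s a)"
| "subst s (Conj a b) = Conj (subst s a) (subst s b)"
| "subst s (Box a) = Box (subst s a)"
| "subst s (Univ a) = Univ (subst s a)"

primrec peval :: "(fm \<Rightarrow> bool) \<Rightarrow> fm \<Rightarrow> bool" where
  "peval v (Var n) = v (Var n)"
| "peval v (Neg a) = (\<not> peval v a)"
| "peval v (Conj a b) = (peval v a \<and> peval v b)"
| "peval v (Box a) = v (Box a)"
| "peval v (Univ a) = v (Univ a)"

definition taut :: "fm \<Rightarrow> bool" where "taut a = (\<forall>v. peval v a)"

abbreviation "P \<equiv> Var 0"
abbreviation "Q \<equiv> Var 1"

definition normal_u :: "fm set \<Rightarrow> bool" where
  "normal_u L \<longleftrightarrow>
     {a. taut a} \<subseteq> L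
   \<and> Imp (Box (Imp P Q)) (Imp (Box P) (Box Q)) \<in> L
   \<and> Imp (Univ (Imp P Q)) (Imp (Univ P) (Univ Q)) \<in> L
   \<and> Imp (Univ P) P \<in> L
   \<and> Imp (Univ P) (Univ (Univ P)) \<in> L
   \<and> Imp P (Univ (Ex P)) \<in> L
   \<and> Imp (Univ P) (Box P) \<in> L
   \<and> (\<forall>a b. a \<in> L \<longrightarrow> Imp a b \<in> L \<longrightarrow> b \<in> L)
   \<and> (\<forall>a. a \<in> L \<longrightarrow> Box a \<in> L)
   \<and> (\<forall>a. a \<in> L \<longrightarrow> Univ a \<in> L)
   \<and> (\<forall>a s. a \<in> L \<longrightarrow> subst s a \<in> L)"

definition Ku :: "fm set" where "Ku = \<Inter>{L. normal_u L}"

definition K4u :: "fm set" where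
  "K4u = \<Inter>{L. normal_u L \<and> Imp (Box P) (Box (Box P)) \<in> L}"

datatype recf = Zero | Succ | Proj nat | Comp recf "recf list" | Prim recf recf | Mn recf

inductive reval :: "recf \<Rightarrow> nat list \<Rightarrow> nat \<Rightarrow> bool" where
  "reval Zero xs 0"
| "reval Succ (x # xs) (Suc x)"
| "i < length xs \<Longrightarrow> reval (Proj i) xs (xs ! i)"
| "list_all2 (\<lambda>g y. reval g xs y) gs ys \<Longrightarrow> reval f ys z \<Longrightarrow> reval (Comp f gs) xs z"
| "reval f xs z \<Longrightarrow> reval (Prim f g) (0 # xs) z"
| "reval (Prim f g) (n # xs) r \<Longrightarrow> reval g (n # r # xs) z \<Longrightarrow> reval (Prim f g) (Suc n # xs) z"
| "reval f (n # xs) 0 \<Longrightarrow> (\<forall>m<n. \<exists>y. y \<noteq> 0 \<and> reval f (m # xs) y) \<Longrightarrow> reval (Mn f) xs n"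

definition decidable :: "nat set \<Rightarrow> bool" where
  "decidable A \<longleftrightarrow> (\<exists>f. \<forall>n. reval f [n] (if n \<in> A then 1 else 0))"

primrec code :: "fm \<Rightarrow> nat" where
  "code (Var n) = prod_encode (0, n)"
| "code (Neg a) = prod_encode (1, code a)"
| "code (Conj a b) = prod_encode (2, prod_encode (code a, code b))"
| "code (Box a) = prod_encode (3, code a)"
| "code (Univ a) = prod_encode (4, code a)"

definition decidable_fm :: "fm set \<Rightarrow> bool" where
  "decidable_fm S \<longleftrightarrow> decidable (code ` S)"

definition unifiable :: "fm set \<Rightarrow> fm \<Rightarrow> bool" where
  "unifiable L a \<longleftrightarrow> (\<exists>s. subst s a \<in> L)"

end

theory Submission
  imports Defs "HOL-Library.Countable"
begin

text \<open>
  The graph of a recursive function is generated by finitely many Horn clauses over tuples of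
  natural numbers. A fact becomes the statement that some point sees the right variable-free
  descriptions of its entries; in a clause, the variables turn into propositional variables. The
  formula "clauses imply goal" is unifiable iff the goal is derivable. If it is derivable, there is a
  substitution that picks, in each model, a clause instance failing there unless the goal holds; such
  case distinctions are possible because facts are statements about the whole model. If it is not
  derivable, then the clauses are valid and the goal fails in a transitive frame that has a point for
  each true fact, whatever formulas are substituted for the variables.

  Undecidability follows by diagonalisation: no universal function is needed, because the code of
  the formula of a function serves as its Goedel number.
\<close>

section \<open>Reasoning in normal logics\<close>

lemmas fm_defs = Disj_def Imp_def Iff_def Bot_def Top_def

locale normal_logic =
  fixes L :: "fm set"
  assumes normal: "normal_u L"
begin

lemma tautI: "taut a \<Longrightarrow> a \<in> L"
  using normal unfolding normal_u_def by blast

lemma mp: "Imp a b \<in> L \<Longrightarrow> a \<in> L \<Longrightarrow> b \<in> L"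
  using normal unfolding normal_u_def by blast

lemma taut_mp: "a \<in> L \<Longrightarrow> taut (Imp a b) \<Longrightarrow> b \<in> L"
  by (blast intro: mp tautI)

lemma taut_mp2: "a \<in> L \<Longrightarrow> b \<in> L \<Longrightarrow> taut (Imp a (Imp b c)) \<Longrightarrow> c \<in> L"
  by (blast intro: mp tautI)

lemma taut_mp3: "a \<in> L \<Longrightarrow> b \<in> L \<Longrightarrow> c \<in> L \<Longrightarrow> taut (Imp a (Imp b (Imp c d))) \<Longrightarrow> d \<in> L"
  by (blast intro: mp tautI)

lemma nec: "a \<in> L \<Longrightarrow> Box a \<in> L" "a \<in> L \<Longrightarrow> Univ a \<in> L"
  using normal unfolding normal_u_def by blast+

lemma instance_in: "a \<in> L \<Longrightarrow> subst s a \<in> L"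
  using normal unfolding normal_u_def by blast

lemma axiom_instances:
  "Imp (Box (Imp a b)) (Imp (Box a) (Box b)) \<in> L"
  "Imp (Univ (Imp a b)) (Imp (Univ a) (Univ b)) \<in> L"
  "Imp (Univ a) a \<in> L"
  "Imp (Univ a) (Univ (Univ a)) \<in> L"
  "Imp a (Univ (Ex a)) \<in> L"
  "Imp (Univ a) (Box a) \<in> L"
proof -
  let ?s = "\<lambda>n::nat. if n = 0 then a else b"
  have ax: "Imp (Box (Imp P Q)) (Imp (Box P) (Box Q)) \<in> L"
    "Imp (Univ (Imp P Q)) (Imp (Univ P) (Univ Q)) \<in> L"
    "Imp (Univ P) P \<in> L" "Imp (Univ P) (Univ (Univ P)) \<in> L"
    "Imp P (Univ (Ex P)) \<in> L" "Imp (Univ P) (Box P) \<in> L"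
    using normal unfolding normal_u_def by blast+
  show "Imp (Box (Imp a b)) (Imp (Box a) (Box b)) \<in> L"
    "Imp (Univ (Imp a b)) (Imp (Univ a) (Univ b)) \<in> L"
    "Imp (Univ a) a \<in> L"
    "Imp (Univ a) (Univ (Univ a)) \<in> L"
    "Imp a (Univ (Ex a)) \<in> L"
    "Imp (Univ a) (Box a) \<in> L"
    using ax[THEN instance_in[where s = ?s]] by (simp_all add: Imp_def Ex_def)
qed

lemma Box_mono: "Imp a b \<in> L \<Longrightarrow> Imp (Box a) (Box b) \<in> L"
  and Univ_mono: "Imp a b \<in> L \<Longrightarrow> Imp (Univ a) (Univ b) \<in> L"
  by (blast intro: mp nec axiom_instances)+

lemma Imp_trans: "Imp a b \<in> L \<Longrightarrow> Imp b c \<in> L \<Longrightarrow> Imp a c \<in> L"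
  by (erule (1) taut_mp2) (auto simp: taut_def fm_defs)

lemma Imp_Conj: "Imp a b \<in> L \<Longrightarrow> Imp a c \<in> L \<Longrightarrow> Imp a (Conj b c) \<in> L"
  by (erule (1) taut_mp2) (auto simp: taut_def fm_defs)

lemma Imp_cong_Box:
  assumes "Imp c (Box c) \<in> L" and "Imp c (Imp a b) \<in> L"
  shows "Imp c (Imp (Box a) (Box b)) \<in> L"
  by (meson assms Box_mono Imp_trans axiom_instances(1))

lemma Imp_cong_Univ:
  assumes "Imp c (Univ c) \<in> L" and "Imp c (Imp a b) \<in> L"
  shows "Imp c (Imp (Univ a) (Univ b)) \<in> L"
  by (meson assms Univ_mono Imp_trans axiom_instances(2))

lemma Imp_Iff: "Imp c (Iff a b) \<in> L \<longleftrightarrow> Imp c (Imp a b) \<in> L \<and> Imp c (Imp b a) \<in> L"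
proof (intro iffI conjI; (elim conjE)?)
  show "Imp c (Iff a b) \<in> L \<Longrightarrow> Imp c (Imp a b) \<in> L"
    by (erule taut_mp) (auto simp: taut_def fm_defs)
  show "Imp c (Iff a b) \<in> L \<Longrightarrow> Imp c (Imp b a) \<in> L"
    by (erule taut_mp) (auto simp: taut_def fm_defs)
  show "Imp c (Imp a b) \<in> L \<Longrightarrow> Imp c (Imp b a) \<in> L \<Longrightarrow> Imp c (Iff a b) \<in> L"
    by (erule (1) taut_mp2) (auto simp: taut_def fm_defs)
qed

section \<open>Provable equivalence as a congruence\<close>

definition eqv :: "fm \<Rightarrow> fm \<Rightarrow> bool" (infix "\<approx>" 50) where
  "a \<approx> b \<longleftrightarrow> Iff a b \<in> L"

lemma eqv_Imp: "a \<approx> b \<longleftrightarrow> Imp a b \<in> L \<and> Imp b a \<in> L"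
proof (intro iffI conjI; (elim conjE)?; unfold eqv_def)
  show "Iff a b \<in> L \<Longrightarrow> Imp a b \<in> L"
    by (erule taut_mp) (auto simp: taut_def fm_defs)
  show "Iff a b \<in> L \<Longrightarrow> Imp b a \<in> L"
    by (erule taut_mp) (auto simp: taut_def fm_defs)
  show "Imp a b \<in> L \<Longrightarrow> Imp b a \<in> L \<Longrightarrow> Iff a b \<in> L"
    by (erule (1) taut_mp2) (auto simp: taut_def fm_defs)
qed

lemma eqv_refl [simp]: "a \<approx> a"
  unfolding eqv_def by (rule tautI) (auto simp: taut_def fm_defs)

lemma eqv_trans [trans]: "a \<approx> b \<Longrightarrow> b \<approx> c \<Longrightarrow> a \<approx> c"
  unfolding eqv_Imp by (blast intro: Imp_trans)

lemma eqv_Neg: "a \<approx> b \<Longrightarrow> Neg a \<approx> Neg b"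
  unfolding eqv_def by (erule taut_mp) (auto simp: taut_def fm_defs)

lemma eqv_Conj: "a \<approx> b \<Longrightarrow> c \<approx> d \<Longrightarrow> Conj a c \<approx> Conj b d"
  unfolding eqv_def by (erule (1) taut_mp2) (auto simp: taut_def fm_defs)

lemma eqv_Box: "a \<approx> b \<Longrightarrow> Box a \<approx> Box b"
  unfolding eqv_Imp by (blast intro: Box_mono)

lemma eqv_Univ: "a \<approx> b \<Longrightarrow> Univ a \<approx> Univ b"
  unfolding eqv_Imp by (blast intro: Univ_mono)

lemma eqv_Dia: "a \<approx> b \<Longrightarrow> Dia a \<approx> Dia b"
  unfolding Dia_def by (intro eqv_Neg eqv_Box)

lemma eqv_Ex: "a \<approx> b \<Longrightarrow> Ex a \<approx> Ex b"
  unfolding Ex_def by (intro eqv_Neg eqv_Univ)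

text \<open>\<open>Bot\<close> contains \<open>Var 0\<close>, so a substitution alters it; the
  descriptions of numbers and positions are therefore invariant only up to provable
  equivalence.\<close>

lemma eqv_Bot: "subst s Bot \<approx> Bot"
  unfolding eqv_def by (rule tautI) (auto simp: taut_def fm_defs)

lemmas eqv_intros = eqv_Neg eqv_Conj eqv_Box eqv_Univ eqv_Dia eqv_Ex

section \<open>Formulas with a model-wide truth value, and case distinctions on them\<close>

definition global :: "fm \<Rightarrow> bool" where
  "global a \<longleftrightarrow> Imp a (Univ a) \<in> L"

lemma global_Univ: "global (Univ a)"
  unfolding global_def by (rule axiom_instances)

text \<open>The S5 argument: contraposition gives that \<open>Ex (Neg a)\<close> implies
  \<open>Neg a\<close>; put this under \<open>Univ\<close> and use that \<open>Neg a\<close> implies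
  \<open>Univ (Ex (Neg a))\<close>.\<close>

lemma global_Neg:
  assumes "global a"
  shows "global (Neg a)"
proof -
  have "Imp a (Univ (Neg (Neg a))) \<in> L"
    using assms unfolding global_def
    by (rule Imp_trans) (rule Univ_mono, rule tautI, auto simp: taut_def fm_defs)
  then have "Imp (Ex (Neg a)) (Neg a) \<in> L"
    unfolding Ex_def by (rule taut_mp) (auto simp: taut_def fm_defs)
  then show ?thesis
    unfolding global_def by (blast intro: Imp_trans Univ_mono axiom_instances)
qed

lemma global_Conj:
  assumes "global a" "global b"
  shows "global (Conj a b)"
proof -
  have "Imp a (Imp b (Conj a b)) \<in> L"
    by (rule tautI) (auto simp: taut_def fm_defs)
  then have "Imp (Univ a) (Imp (Univ b) (Univ (Conj a b))) \<in> L"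
    by (blast intro: Imp_trans Univ_mono axiom_instances)
  with assms show ?thesis
    unfolding global_def by (rule taut_mp3) (auto simp: taut_def fm_defs)
qed

lemma global_Ex: "global (Ex a)"
  unfolding Ex_def by (intro global_Neg global_Univ)

lemma global_Imp: "global a \<Longrightarrow> global b \<Longrightarrow> global (Imp a b)"
  unfolding Imp_def by (intro global_Neg global_Conj)

lemma global_taut: "taut a \<Longrightarrow> global a"
  unfolding global_def by (rule taut_mp[OF nec(2)[OF tautI]]) (auto simp: taut_def fm_defs)

definition merge :: "fm \<Rightarrow> (nat \<Rightarrow> fm) \<Rightarrow> (nat \<Rightarrow> fm) \<Rightarrow> nat \<Rightarrow> fm" where
  "merge c s t n = Disj (Conj c (s n)) (Conj (Neg c) (t n))"

text \<open>Replacement of equivalents under the hypothesis \<open>c\<close>. It passes through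
  \<open>Box\<close> and \<open>Univ\<close> because a global \<open>c\<close> implies
  \<open>Univ c\<close>, hence \<open>Box c\<close>.\<close>

lemma subst_relative:
  assumes c: "global c" and st: "\<And>n. Imp c (Iff (s n) (t n)) \<in> L"
  shows "Imp c (Iff (subst s a) (subst t a)) \<in> L"
proof (induction a)
  case (Var n)
  then show ?case using st by simp
next
  case (Neg a)
  then show ?case
    by simp (erule taut_mp, auto simp: taut_def fm_defs)
next
  case (Conj a b)
  then show ?case
    by simp (erule (1) taut_mp2, auto simp: taut_def fm_defs)
next
  case (Box a)
  have "Imp c (Box c) \<in> L"
    using c unfolding global_def by (blast intro: Imp_trans axiom_instances)
  with Box show ?case by (simp add: Imp_Iff Imp_cong_Box)
next
  case (Univ a)
  with c show ?case by (simp add: Imp_Iff Imp_cong_Univ global_def)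
qed

lemma subst_merge:
  assumes "global c"
  shows "Imp c (Iff (subst (merge c s t) a) (subst s a)) \<in> L"
    and "Imp (Neg c) (Iff (subst (merge c s t) a) (subst t a)) \<in> L"
proof -
  show "Imp c (Iff (subst (merge c s t) a) (subst s a)) \<in> L"
    by (rule subst_relative[OF assms], rule tautI) (auto simp: taut_def fm_defs merge_def)
  show "Imp (Neg c) (Iff (subst (merge c s t) a) (subst t a)) \<in> L"
    by (rule subst_relative[OF global_Neg[OF assms]], rule tautI)
       (auto simp: taut_def fm_defs merge_def)
qed

end

section \<open>Horn clauses as formulas\<close>

datatype tm = V nat | Z | S tm

primrec eval :: "(nat \<Rightarrow> nat) \<Rightarrow> tm \<Rightarrow> nat" where
  "eval e (V i) = e i"
| "eval e Z = 0"
| "eval e (S t) = Suc (eval e t)"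

type_synonym clause = "tm list list \<times> tm list"

inductive derivable :: "clause set \<Rightarrow> nat list \<Rightarrow> bool" for K where
  step: "(ps, c) \<in> K \<Longrightarrow> \<forall>p\<in>set ps. derivable K (map (eval e) p) \<Longrightarrow> derivable K (map (eval e) c)"

primrec conjs :: "fm list \<Rightarrow> fm" where
  "conjs [] = Top"
| "conjs (a # as) = Conj a (conjs as)"

primrec boxes :: "nat \<Rightarrow> fm" where
  "boxes 0 = Bot"
| "boxes (Suc n) = Box (boxes n)"

text \<open>The longest path from the point has exactly \<open>n\<close> steps.\<close>

definition rank :: "nat \<Rightarrow> fm" where
  "rank n = Conj (boxes (Suc n)) (Neg (boxes n))"

text \<open>Neither a dead end nor seeing one: in the frame built below, this singles out
  \<open>Loop\<close>.\<close>

definition refl_fm :: fm where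
  "refl_fm = Neg (Disj (boxes 1) (Dia (boxes 1)))"

definition chain :: fm where
  "chain = Conj (Dia refl_fm) (Neg (Disj refl_fm (Dia (rank 1))))"

definition zero_fm :: fm where
  "zero_fm = Conj chain (Neg (Dia chain))"

text \<open>If \<open>a\<close> marks a single link, this marks the next one, since all later links
  see \<open>a\<close> in two steps as well.\<close>

definition suc_fm :: "fm \<Rightarrow> fm" where
  "suc_fm a = Conj chain (Conj (Dia a) (Neg (Dia (Dia a))))"

text \<open>At links of the chain, this is true at most once, whatever \<open>a\<close> is: at the least link
  satisfying \<open>a\<close>. Thus a substituted variable always behaves as a number, or is undefined.\<close>

definition least_fm :: "fm \<Rightarrow> fm" where
  "least_fm a = Conj (Conj chain a) (Neg (Dia (Conj chain a)))"

primrec tm_fm :: "tm \<Rightarrow> fm" where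
  "tm_fm (V i) = least_fm (Var i)"
| "tm_fm Z = zero_fm"
| "tm_fm (S t) = suc_fm (tm_fm t)"

text \<open>Position \<open>j\<close> is marked by rank \<open>j + 1\<close>, because \<^const>\<open>chain\<close> uses visibility of rank \<open>1\<close>
  to tell the cells from the links of the chain.\<close>

definition entry :: "nat \<Rightarrow> fm \<Rightarrow> fm" where
  "entry j a = Conj (Conj (Dia (rank (Suc j))) (Neg (Dia (rank (Suc (Suc j))))))
                    (Conj (Dia a) (Neg (Dia (suc_fm a))))"

primrec entries :: "nat \<Rightarrow> fm list \<Rightarrow> fm" where
  "entries j [] = Top"
| "entries j (a # as) = Conj (Dia (entry j a)) (entries (Suc j) as)"

text \<open>\<open>Ex\<close> makes a fact a property of the whole model, as the case distinctions
  require.\<close>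

definition atom_fm :: "fm list \<Rightarrow> fm" where
  "atom_fm as = Ex (entries 0 as)"

definition clause_fm :: "clause \<Rightarrow> fm" where
  "clause_fm k = Imp (conjs (map (\<lambda>p. atom_fm (map tm_fm p)) (fst k))) (atom_fm (map tm_fm (snd k)))"

definition clauses_fm :: "clause list \<Rightarrow> fm" where
  "clauses_fm ks = conjs (map clause_fm ks)"

primrec num :: "nat \<Rightarrow> tm" where
  "num 0 = Z"
| "num (Suc n) = S (num n)"

lemma eval_num [simp]: "eval e (num n) = n"
  by (induction n) auto

definition fact_fm :: "nat list \<Rightarrow> fm" where
  "fact_fm w = atom_fm (map (\<lambda>n. tm_fm (num n)) w)"

lemma subst_defs:
  "subst s (Imp a b) = Imp (subst s a) (subst s b)"
  "subst s (Disj a b) = Disj (subst s a) (subst s b)"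
  "subst s (Dia a) = Dia (subst s a)"
  "subst s (Ex a) = Ex (subst s a)"
  by (simp_all add: Imp_def Disj_def Dia_def Ex_def)

lemma peval_defs [simp]:
  "peval v (Imp a b) \<longleftrightarrow> (peval v a \<longrightarrow> peval v b)"
  "peval v (Iff a b) \<longleftrightarrow> (peval v a \<longleftrightarrow> peval v b)"
  "peval v (Disj a b) \<longleftrightarrow> peval v a \<or> peval v b"
  "peval v Bot \<longleftrightarrow> False" "peval v Top \<longleftrightarrow> True"
  by (auto simp: fm_defs)

lemma peval_conjs [simp]: "peval v (conjs as) \<longleftrightarrow> (\<forall>a\<in>set as. peval v a)"
  by (induction as) auto

lemma peval_subst_conjs [simp]:
  "peval v (subst s (conjs as)) \<longleftrightarrow> (\<forall>a\<in>set as. peval v (subst s a))"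
  by (induction as) (auto simp: Top_def Bot_def)

section \<open>Derivable facts yield unifiers\<close>

context normal_logic
begin

definition closed :: "fm \<Rightarrow> bool" where
  "closed a \<longleftrightarrow> (\<forall>s. subst s a \<approx> a)"

lemma closedI:
  "closed Bot" "closed a \<Longrightarrow> closed (Neg a)" "closed a \<Longrightarrow> closed b \<Longrightarrow> closed (Conj a b)"
  "closed a \<Longrightarrow> closed (Box a)" "closed a \<Longrightarrow> closed (Univ a)"
  by (auto simp: closed_def eqv_Bot intro: eqv_intros)

lemma closed_derived:
  "closed Top" "closed a \<Longrightarrow> closed b \<Longrightarrow> closed (Disj a b)" "closed a \<Longrightarrow> closed (Dia a)"
  "closed a \<Longrightarrow> closed (Ex a)"
  unfolding Top_def Disj_def Dia_def Ex_def by (intro closedI; assumption)+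

lemma closed_boxes: "closed (boxes n)"
  by (induction n) (auto intro: closedI)

lemma closed_rank: "closed (rank n)"
  unfolding rank_def by (intro closedI closed_boxes)

lemma closed_chain: "closed chain"
  unfolding chain_def refl_fm_def by (intro closedI closed_derived closed_boxes closed_rank)

lemma closed_num: "closed (tm_fm (num n))"
  by (induction n) (auto simp: zero_fm_def suc_fm_def intro!: closedI closed_derived closed_chain)

lemma subst_suc: "subst s a \<approx> b \<Longrightarrow> subst s (suc_fm a) \<approx> suc_fm b"
  unfolding suc_fm_def using closed_chain
  by (auto simp: subst_defs closed_def intro!: eqv_intros)

lemma subst_least: "subst s a \<approx> b \<Longrightarrow> subst s (least_fm a) \<approx> least_fm b"
  unfolding least_fm_def using closed_chain
  by (auto simp: subst_defs closed_def intro!: eqv_intros)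

lemma subst_entry: "subst s a \<approx> b \<Longrightarrow> subst s (entry j a) \<approx> entry j b"
  unfolding entry_def using closed_rank
  by (auto simp: subst_defs closed_def intro!: eqv_intros subst_suc)

lemma subst_entries:
  "list_all2 (\<lambda>a b. subst s a \<approx> b) as bs \<Longrightarrow> subst s (entries j as) \<approx> entries j bs"
proof (induction as bs arbitrary: j rule: list_all2_induct)
  case Nil
  show ?case using closed_derived(1) by (simp add: closed_def)
next
  case (Cons a as b bs)
  then show ?case by (auto simp: subst_defs intro!: eqv_intros subst_entry)
qed

lemma Dia_mono: "Imp a b \<in> L \<Longrightarrow> Imp (Dia a) (Dia b) \<in> L"
proof -
  assume "Imp a b \<in> L"
  then have "Imp (Neg b) (Neg a) \<in> L"
    by (rule taut_mp) (auto simp: taut_def)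
  from Box_mono[OF this] show ?thesis
    unfolding Dia_def by (rule taut_mp) (auto simp: taut_def)
qed

text \<open>Holds in every normal logic: a point of \<open>num (Suc m)\<close> sees
  \<open>num m\<close> but not in two steps, so it cannot see another point of
  \<open>num (Suc m)\<close>. A point of \<open>num 0\<close> sees no link at all.\<close>

lemma least_num: "least_fm (tm_fm (num n)) \<approx> tm_fm (num n)"
proof -
  let ?a = "tm_fm (num n)"
  have chain: "Imp ?a chain \<in> L"
    by (cases n) (auto simp: taut_def zero_fm_def suc_fm_def intro!: tautI)
  have "Imp ?a (Neg (Dia ?a)) \<in> L"
  proof (cases n)
    case 0
    from Dia_mono[OF chain] show ?thesis
      by (rule taut_mp) (auto simp: taut_def 0 zero_fm_def)
  next
    case (Suc m)
    have "Imp ?a (Dia (tm_fm (num m))) \<in> L"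
      by (rule tautI) (auto simp: taut_def Suc suc_fm_def)
    from Dia_mono[OF this] show ?thesis
      by (rule taut_mp) (auto simp: taut_def Suc suc_fm_def)
  qed
  moreover have "Conj chain ?a \<approx> ?a"
    unfolding eqv_def using chain by (rule taut_mp) (auto simp: taut_def)
  moreover from this have "Imp (Dia (Conj chain ?a)) (Dia ?a) \<in> L"
    using eqv_Dia eqv_Imp by blast
  ultimately show ?thesis
    unfolding eqv_def least_fm_def by (rule taut_mp3) (auto simp: taut_def)
qed

lemma subst_tm: "subst (\<lambda>i. tm_fm (num (e i))) (tm_fm t) \<approx> tm_fm (num (eval e t))"
proof (induction t)
  case (V i)
  show ?case
    by simp (rule eqv_trans[OF subst_least[OF eqv_refl]], simp add: least_num)
next
  case Z
  show ?case using closed_num[of 0] by (simp add: closed_def)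
next
  case (S t)
  then show ?case by (simp add: subst_suc)
qed

lemma subst_atom:
  "subst (\<lambda>i. tm_fm (num (e i))) (atom_fm (map tm_fm p)) \<approx> fact_fm (map (eval e) p)"
  unfolding fact_fm_def atom_fm_def subst_defs
  by (intro eqv_Ex subst_entries) (auto simp: list_all2_conv_all_nth subst_tm)

lemma closed_fact: "subst s (fact_fm w) \<approx> fact_fm w"
  unfolding fact_fm_def atom_fm_def subst_defs using closed_num
  by (intro eqv_Ex subst_entries) (auto simp: list_all2_conv_all_nth closed_def)

lemma global_subst_conjs: "(\<And>a. a \<in> set as \<Longrightarrow> global (subst s a)) \<Longrightarrow> global (subst s (conjs as))"
proof (induction as)
  case Nil
  show ?case by (rule global_taut) (simp add: taut_def Top_def Bot_def)
next
  case (Cons a as)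
  then show ?case by (simp add: global_Conj)
qed

lemma global_subst_clauses: "global (subst s (clauses_fm ks))"
  by (auto simp: clauses_fm_def clause_fm_def atom_fm_def subst_defs
      intro!: global_subst_conjs global_Imp global_Ex)

text \<open>This says that \<open>s\<close> unifies the formula for \<open>w\<close>, with the
  conclusion left unsubstituted because \<open>fact_fm w\<close> is invariant up to
  equivalence.\<close>

definition forces :: "clause list \<Rightarrow> (nat \<Rightarrow> fm) \<Rightarrow> nat list \<Rightarrow> bool" where
  "forces ks s w \<longleftrightarrow> Imp (subst s (clauses_fm ks)) (fact_fm w) \<in> L"

lemma merge_clauses:
  assumes "global c"
  shows "Imp c (Iff (subst (merge c s t) (clauses_fm ks)) (subst s (clauses_fm ks))) \<in> L"
    and "Imp (Neg c) (Iff (subst (merge c s t) (clauses_fm ks)) (subst t (clauses_fm ks))) \<in> L"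
  using assms by (rule subst_merge)+

text \<open>Where the clauses fail under \<open>s\<close> they fail under the merged substitution too, so whenever the
  latter satisfies the clauses, both \<open>s\<close> and \<open>t\<close> do. This is what makes unifiers of several facts
  combine.\<close>

lemma forces_merge1:
  assumes "forces ks s w"
  shows "forces ks (merge (Neg (subst s (clauses_fm ks))) s t) w"
  using assms merge_clauses(1)[OF global_Neg[OF global_subst_clauses], of s ks s t ks]
  unfolding forces_def by (rule taut_mp2) (auto simp: taut_def)

lemma forces_merge2:
  assumes "forces ks t w"
  shows "forces ks (merge (Neg (subst s (clauses_fm ks))) s t) w"
  using assms
    merge_clauses[OF global_Neg[OF global_subst_clauses], of s ks s t ks]
  unfolding forces_def by (rule taut_mp3) (auto simp: taut_def)

lemma forces_all:
  assumes "\<forall>w\<in>set ws. \<exists>s. forces ks s w"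
  shows "\<exists>s. \<forall>w\<in>set ws. forces ks s w"
  using assms
proof (induction ws)
  case (Cons w ws)
  then obtain s t where "forces ks s w" "\<forall>w\<in>set ws. forces ks t w" by auto
  then show ?case
    using forces_merge1 forces_merge2 by (metis set_ConsD)
qed simp

lemma Imp_conjs: "(\<And>a. a \<in> set as \<Longrightarrow> Imp c a \<in> L) \<Longrightarrow> Imp c (conjs as) \<in> L"
  by (induction as) (auto intro: Imp_Conj tautI simp: taut_def)

text \<open>Induction on the derivation: \<open>s\<close> forces all premises, \<open>t\<close>
  instantiates the last clause by numerals. Their merge \<open>r\<close> forces the conclusion,
  since the clauses under \<open>r\<close> imply the clauses under both \<open>s\<close> and
  \<open>t\<close>.\<close>

lemma derivable_forces:
  assumes "derivable (set ks) w"
  shows "\<exists>s. forces ks s w"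
  using assms
proof induction
  case (step ps c e)
  then have "\<forall>w\<in>set (map (map (eval e)) ps). \<exists>s. forces ks s w" by simp
  from forces_all[OF this] obtain s
    where s: "\<And>p. p \<in> set ps \<Longrightarrow> forces ks s (map (eval e) p)" by auto
  define t where "t i = tm_fm (num (e i))" for i
  define r where "r = merge (Neg (subst s (clauses_fm ks))) s t"
  have "Imp (subst r (clauses_fm ks)) (subst t (clauses_fm ks)) \<in> L"
    using merge_clauses[OF global_Neg[OF global_subst_clauses], of s ks s t ks, folded r_def]
    by (rule taut_mp2) (auto simp: taut_def)
  moreover have "Imp (subst t (clauses_fm ks)) (subst t (clause_fm (ps, c))) \<in> L"
    using step(1) by (auto simp: clauses_fm_def taut_def intro!: tautI)
  ultimately have "Imp (subst r (clauses_fm ks)) (subst t (clause_fm (ps, c))) \<in> L"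
    by (rule Imp_trans)
  moreover have "Imp (subst r (clauses_fm ks))
      (conjs (map (\<lambda>p. subst t (atom_fm (map tm_fm p))) ps)) \<in> L"
  proof (rule Imp_conjs)
    fix a assume "a \<in> set (map (\<lambda>p. subst t (atom_fm (map tm_fm p))) ps)"
    then obtain p where p: "p \<in> set ps" and a: "a = subst t (atom_fm (map tm_fm p))" by auto
    have "Imp (fact_fm (map (eval e) p)) a \<in> L"
      using subst_atom[of e p] unfolding a t_def eqv_Imp by simp
    with forces_merge1[OF s[OF p], of t] show "Imp (subst r (clauses_fm ks)) a \<in> L"
      unfolding forces_def r_def by (blast intro: Imp_trans)
  qed
  moreover have "Imp (subst t (atom_fm (map tm_fm c))) (fact_fm (map (eval e) c)) \<in> L"
    using subst_atom[of e c] unfolding t_def eqv_Imp by simp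
  ultimately have "forces ks r (map (eval e) c)"
    unfolding forces_def
    by (rule taut_mp3) (auto simp: taut_def clause_fm_def subst_defs)
  then show ?case by blast
qed

theorem derivable_unifiable:
  assumes "derivable (set ks) w"
  shows "unifiable L (Imp (clauses_fm ks) (fact_fm w))"
proof -
  obtain s where "Imp (subst s (clauses_fm ks)) (fact_fm w) \<in> L"
    using derivable_forces[OF assms] unfolding forces_def by blast
  moreover have "Imp (fact_fm w) (subst s (fact_fm w)) \<in> L"
    using closed_fact eqv_Imp by blast
  ultimately show ?thesis
    unfolding unifiable_def subst_defs by (blast intro: Imp_trans)
qed

end

section \<open>A transitive frame refuting underivable facts\<close>

primrec sat :: "('w \<Rightarrow> 'w \<Rightarrow> bool) \<Rightarrow> (nat \<Rightarrow> 'w \<Rightarrow> bool) \<Rightarrow> fm \<Rightarrow> 'w \<Rightarrow> bool" where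
  "sat r v (Var n) x = v n x"
| "sat r v (Neg a) x = (\<not> sat r v a x)"
| "sat r v (Conj a b) x = (sat r v a x \<and> sat r v b x)"
| "sat r v (Box a) x = (\<forall>y. r x y \<longrightarrow> sat r v a y)"
| "sat r v (Univ a) x = (\<forall>y. sat r v a y)"

lemma sat_defs [simp]:
  "sat r v (Disj a b) x \<longleftrightarrow> sat r v a x \<or> sat r v b x"
  "sat r v (Imp a b) x \<longleftrightarrow> (sat r v a x \<longrightarrow> sat r v b x)"
  "sat r v Bot x \<longleftrightarrow> False" "sat r v Top x \<longleftrightarrow> True"
  "sat r v (Dia a) x \<longleftrightarrow> (\<exists>y. r x y \<and> sat r v a y)"
  "sat r v (Ex a) x \<longleftrightarrow> (\<exists>y. sat r v a y)"
  by (auto simp: fm_defs Dia_def Ex_def)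

lemma sat_subst: "sat r v (subst s a) x \<longleftrightarrow> sat r (\<lambda>n. sat r v (s n)) a x"
  by (induction a arbitrary: x) auto

lemma peval_sat: "peval (\<lambda>b. sat r v b x) a \<longleftrightarrow> sat r v a x"
  by (induction a) auto

definition valid :: "('w \<Rightarrow> 'w \<Rightarrow> bool) \<Rightarrow> fm \<Rightarrow> bool" where
  "valid r a \<longleftrightarrow> (\<forall>v x. sat r v a x)"

lemma validI: "(\<And>v x. sat r v a x) \<Longrightarrow> valid r a"
  and validD: "valid r a \<Longrightarrow> sat r v a x"
  by (simp_all add: valid_def)

lemma normal_valid: "normal_u {a. valid r a}"
  unfolding normal_u_def mem_Collect_eq Collect_mono_iff
proof (intro conjI allI impI)
  fix a assume "taut a"
  then show "valid r a"
    using peval_sat[of r _ _ a] by (auto simp: taut_def intro: validI)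
next
  fix a b assume "valid r a" "valid r (Imp a b)"
  then show "valid r b"
    by (metis validI validD sat_defs(2))
qed (auto simp: sat_subst intro!: validI dest: validD)

text \<open>The formulas valid in a transitive frame form one of the logics intersected in
  \<open>K4u\<close>.\<close>

lemma K4u_sound:
  assumes "a \<in> K4u" and "transp r"
  shows "sat r v a x"
proof -
  have "valid r (Imp (Box P) (Box (Box P)))"
    using assms(2) by (intro validI) (auto dest: transpD)
  with assms(1) normal_valid[of r] have "valid r a" unfolding K4u_def by blast
  then show ?thesis by (rule validD)
qed

text \<open>The frame: a reflexive point \<open>Loop\<close>, an irreflexive chain of ranks (marking argument
  positions), an irreflexive chain of links (marking argument values), a cell for each pair of a
  position and a value, and a point for each fact, which sees the cells of its entries if the fact
  belongs to \<open>T\<close> and no cell otherwise.\<close>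

datatype pt = Loop | Rank nat | Link nat | Cell nat nat | Fact "nat list"

fun rel :: "nat list set \<Rightarrow> pt \<Rightarrow> pt \<Rightarrow> bool" where
  "rel T Loop y \<longleftrightarrow> y = Loop"
| "rel T (Rank i) y \<longleftrightarrow> (\<exists>m<i. y = Rank m)"
| "rel T (Link n) y \<longleftrightarrow> y = Loop \<or> y = Rank 0 \<or> (\<exists>m<n. y = Link m)"
| "rel T (Cell j n) y \<longleftrightarrow> y = Loop \<or> (\<exists>m\<le>Suc j. y = Rank m) \<or> (\<exists>m\<le>n. y = Link m)"
| "rel T (Fact w) y \<longleftrightarrow> y = Loop \<or> (\<exists>m. y = Rank m) \<or> (\<exists>m. y = Link m) \<or>
     (w \<in> T \<and> (\<exists>j<length w. y = Cell j (w ! j)))"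

lemma transp_rel: "transp (rel T)"
proof (rule transpI)
  fix x y z assume "rel T x y" "rel T y z"
  then show "rel T x z" by (cases x; cases y) auto
qed

abbreviation "sem T \<equiv> sat (rel T)"

text \<open>Only ranks have bounded paths: every other point sees \<open>Loop\<close>, which sees
  itself.\<close>

lemma sem_boxes: "sem T v (boxes n) x \<longleftrightarrow> (\<exists>i<n. x = Rank i)"
proof (induction n arbitrary: x)
  case (Suc n)
  then have "sem T v (boxes (Suc n)) x \<longleftrightarrow> (\<forall>y. rel T x y \<longrightarrow> (\<exists>i<n. y = Rank i))" by simp
  also have "\<dots> \<longleftrightarrow> (\<exists>i<Suc n. x = Rank i)"
  proof (cases x)
    case (Rank i)
    have "(\<forall>m<i. m < n) \<longleftrightarrow> i \<le> n" by (meson less_le_trans linorder_not_le less_irrefl)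
    moreover have "(\<forall>y. (\<exists>m<i. y = Rank m) \<longrightarrow> (\<exists>i<n. y = Rank i)) \<longleftrightarrow> (\<forall>m<i. m < n)" by auto
    ultimately show ?thesis by (simp add: Rank less_Suc_eq_le)
  qed auto
  finally show ?case .
qed simp

lemma sem_rank: "sem T v (rank n) x \<longleftrightarrow> x = Rank n"
  unfolding rank_def sat.simps sem_boxes by (auto simp: less_Suc_eq)

text \<open>Every point other than \<open>Loop\<close> is \<open>Rank 0\<close>, the only dead end,
  or sees it.\<close>

lemma sem_refl_fm: "sem T v refl_fm x \<longleftrightarrow> x = Loop"
  unfolding refl_fm_def sat.simps sat_defs sem_boxes
  by (cases x) auto

text \<open>Ranks do not see \<open>Loop\<close>; cells and fact points see \<open>Rank 1\<close>,
  while the only rank seen by a link is \<open>Rank 0\<close>.\<close>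

lemma sem_chain: "sem T v chain x \<longleftrightarrow> (\<exists>n. x = Link n)"
  unfolding chain_def sat.simps sat_defs sem_refl_fm sem_rank
  by (cases x) auto

lemma sem_zero: "sem T v zero_fm x \<longleftrightarrow> x = Link 0"
  unfolding zero_fm_def sat.simps sat_defs sem_chain
  by (cases x) auto

text \<open>The truth value \<open>c\<close> tells whether the described number is defined; if not,
  both \<open>a\<close> and \<open>suc_fm a\<close> are true nowhere.\<close>

lemma sem_suc:
  assumes "\<And>x. sem T v a x \<longleftrightarrow> c \<and> x = Link n"
  shows "sem T v (suc_fm a) x \<longleftrightarrow> c \<and> x = Link (Suc n)"
proof -
  have "sem T v (suc_fm a) x \<longleftrightarrow> (\<exists>m. x = Link m) \<and> c \<and> rel T x (Link n)
      \<and> \<not> (\<exists>y. rel T x y \<and> rel T y (Link n))"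
    unfolding suc_fm_def sat.simps sat_defs sem_chain assms by auto
  also have "\<dots> \<longleftrightarrow> c \<and> x = Link (Suc n)"
  proof (cases x)
    case (Link m)
    have "(\<exists>y. rel T x y \<and> rel T y (Link n)) \<longleftrightarrow> Suc n < m"
    proof
      assume "Suc n < m"
      then have "rel T x (Link (Suc n)) \<and> rel T (Link (Suc n)) (Link n)" unfolding Link by simp
      then show "\<exists>y. rel T x y \<and> rel T y (Link n)" by blast
    qed (auto simp: Link)
    then show ?thesis using Link by auto
  qed auto
  finally show ?thesis .
qed

text \<open>A valuation is read as a partial assignment of numbers to variables; the value is
  arbitrary outside \<open>defd v\<close>.\<close>

definition env :: "(nat \<Rightarrow> pt \<Rightarrow> bool) \<Rightarrow> nat \<Rightarrow> nat" where
  "env v i = (LEAST n. v i (Link n))"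

primrec vars :: "tm \<Rightarrow> nat set" where
  "vars (V i) = {i}"
| "vars Z = {}"
| "vars (S t) = vars t"

definition defd :: "(nat \<Rightarrow> pt \<Rightarrow> bool) \<Rightarrow> nat set" where
  "defd v = {i. \<exists>n. v i (Link n)}"

lemma sem_tm: "sem T v (tm_fm t) x \<longleftrightarrow> vars t \<subseteq> defd v \<and> x = Link (eval (env v) t)"
proof (induction t arbitrary: x)
  case (V i)
  have "sem T v (tm_fm (V i)) x \<longleftrightarrow> (\<exists>n. x = Link n \<and> v i (Link n) \<and> (\<forall>m<n. \<not> v i (Link m)))"
    unfolding tm_fm.simps least_fm_def sat.simps sat_defs sem_chain by (cases x) auto
  also have "\<dots> \<longleftrightarrow> i \<in> defd v \<and> x = Link (env v i)"
  proof
    assume "\<exists>n. x = Link n \<and> v i (Link n) \<and> (\<forall>m<n. \<not> v i (Link m))"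
    then obtain n where n: "x = Link n" "v i (Link n)" "\<forall>m<n. \<not> v i (Link m)" by blast
    then have "env v i = n" unfolding env_def by (intro Least_equality) (auto simp: not_less[symmetric])
    with n show "i \<in> defd v \<and> x = Link (env v i)" by (auto simp: defd_def)
  next
    assume "i \<in> defd v \<and> x = Link (env v i)"
    moreover from this have "v i (Link (env v i))"
      unfolding env_def defd_def by (auto intro: LeastI)
    moreover have "\<not> v i (Link m)" if "m < env v i" for m
      using that unfolding env_def by (rule not_less_Least)
    ultimately show "\<exists>n. x = Link n \<and> v i (Link n) \<and> (\<forall>m<n. \<not> v i (Link m))" by blast
  qed
  finally show ?case by simp
next
  case (S t)
  then show ?case unfolding tm_fm.simps by (subst sem_suc) auto
qed (simp add: sem_zero)

text \<open>The highest visible rank gives the position, the highest visible link the value. Only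
  cells have a highest visible rank above \<open>0\<close> together with a highest visible
  link.\<close>

lemma sem_entry:
  assumes "\<And>x. sem T v a x \<longleftrightarrow> c \<and> x = Link n"
  shows "sem T v (entry j a) x \<longleftrightarrow> c \<and> x = Cell j n"
proof -
  have "sem T v (entry j a) x \<longleftrightarrow> rel T x (Rank (Suc j)) \<and> \<not> rel T x (Rank (Suc (Suc j))) \<and>
      c \<and> rel T x (Link n) \<and> \<not> rel T x (Link (Suc n))"
    unfolding entry_def sat.simps sat_defs sem_rank assms sem_suc[OF assms] by auto
  also have "\<dots> \<longleftrightarrow> c \<and> x = Cell j n"
    by (cases x) auto
  finally show ?thesis .
qed

text \<open>\<open>atom_fm\<close> does not constrain entries beyond the listed ones, so the frame
  can only test for prefixes of facts.\<close>

definition matches :: "nat list \<Rightarrow> nat list \<Rightarrow> bool" where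
  "matches p w \<longleftrightarrow> take (length p) w = p"

lemma sem_entries:
  "sem T v (entries j (map tm_fm ts)) x \<longleftrightarrow> (\<Union>(vars ` set ts) \<subseteq> defd v) \<and>
     (\<forall>i<length ts. rel T x (Cell (j + i) (eval (env v) (ts ! i))))"
proof (induction ts arbitrary: j)
  case (Cons t ts)
  have "sem T v (Dia (entry j (tm_fm t))) x \<longleftrightarrow> vars t \<subseteq> defd v \<and> rel T x (Cell j (eval (env v) t))"
    unfolding sat_defs by (subst sem_entry[OF sem_tm]) auto
  then show ?case
    using Cons by (auto simp: All_less_Suc2)
qed simp

lemma sem_atom:
  assumes "ts \<noteq> []"
  shows "sem T v (atom_fm (map tm_fm ts)) x \<longleftrightarrow> (\<Union>(vars ` set ts) \<subseteq> defd v) \<and>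
     (\<exists>w\<in>T. matches (map (eval (env v)) ts) w)"
proof -
  have "(\<exists>y. \<forall>i<length ts. rel T y (Cell i (eval (env v) (ts ! i)))) \<longleftrightarrow>
      (\<exists>w\<in>T. matches (map (eval (env v)) ts) w)" (is "?l \<longleftrightarrow> ?r")
  proof
    assume ?l
    then obtain y where y: "\<forall>i<length ts. rel T y (Cell i (eval (env v) (ts ! i)))" ..
    \<comment> \<open>The first entry alone forces \<open>y\<close> to be the point of a fact in
      \<open>T\<close>, because no other points see cells.\<close>
    with assms have "rel T y (Cell 0 (eval (env v) (ts ! 0)))" by simp
    then obtain w where w: "y = Fact w" "w \<in> T" by (cases y) auto
    have *: "i < length w \<and> w ! i = eval (env v) (ts ! i)" if "i < length ts" for i
      using y that w by auto
    have "length ts \<le> length w"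
      using * by (meson leI less_irrefl)
    then have "matches (map (eval (env v)) ts) w"
      unfolding matches_def using * by (intro nth_equalityI) auto
    with w show ?r by blast
  next
    assume ?r
    then obtain w where w: "w \<in> T" "take (length ts) w = map (eval (env v)) ts"
      unfolding matches_def by auto
    then have le: "length ts \<le> length w" by (metis length_map length_take min.absorb_iff2 min.commute)
    have "w ! i = eval (env v) (ts ! i)" if "i < length ts" for i
      using w(2) that by (metis nth_map nth_take)
    with le w(1) have "\<forall>i<length ts. rel T (Fact w) (Cell i (eval (env v) (ts ! i)))" by auto
    then show ?l ..
  qed
  then show ?thesis unfolding atom_fm_def sat_defs sem_entries by auto
qed

text \<open>A conclusion containing an undefined variable is false, hence the need for this condition.\<close>

definition range_restricted :: "clause \<Rightarrow> bool" where
  "range_restricted k \<longleftrightarrow> \<Union>(vars ` set (snd k)) \<subseteq> (\<Union>p\<in>set (fst k). \<Union>(vars ` set p))"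

definition closed_under :: "nat list set \<Rightarrow> clause \<Rightarrow> bool" where
  "closed_under T k \<longleftrightarrow> (\<forall>e. (\<forall>p\<in>set (fst k). \<exists>w\<in>T. matches (map (eval e) p) w)
     \<longrightarrow> (\<exists>w\<in>T. matches (map (eval e) (snd k)) w))"

lemma sem_conjs: "sat r v (conjs as) x \<longleftrightarrow> (\<forall>a\<in>set as. sat r v a x)"
  by (induction as) auto

lemma sem_clause:
  assumes "range_restricted k" "closed_under T k" "\<forall>p\<in>insert (snd k) (set (fst k)). p \<noteq> []"
  shows "sem T v (clause_fm k) x"
proof -
  have *: "sem T v (atom_fm (map tm_fm p)) x \<longleftrightarrow> \<Union>(vars ` set p) \<subseteq> defd v \<and>
      (\<exists>w\<in>T. matches (map (eval (env v)) p) w)" if "p \<in> insert (snd k) (set (fst k))" for p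
    using that assms(3) by (intro sem_atom) auto
  show ?thesis
    unfolding clause_fm_def sat_defs
  proof
    assume "sem T v (conjs (map (\<lambda>p. atom_fm (map tm_fm p)) (fst k))) x"
    then have prems: "\<forall>p\<in>set (fst k). \<Union>(vars ` set p) \<subseteq> defd v \<and> 
        (\<exists>w\<in>T. matches (map (eval (env v)) p) w)"
      using * by (auto simp: sem_conjs)
    then have "\<exists>w\<in>T. matches (map (eval (env v)) (snd k)) w"
      using assms(2) unfolding closed_under_def by blast
    moreover have "\<Union>(vars ` set (snd k)) \<subseteq> defd v"
      using prems assms(1) unfolding range_restricted_def by blast
    ultimately show "sem T v (atom_fm (map tm_fm (snd k))) x" using * by simp
  qed
qed

theorem not_unifiable:
  assumes "L \<subseteq> K4u"
    and "\<forall>k\<in>set ks. range_restricted k \<and> closed_under T k \<and> (\<forall>p\<in>insert (snd k) (set (fst k)). p \<noteq> [])"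
    and "g \<noteq> []" "\<not> (\<exists>w\<in>T. matches g w)"
  shows "\<not> unifiable L (Imp (clauses_fm ks) (fact_fm g))"
proof
  assume "unifiable L (Imp (clauses_fm ks) (fact_fm g))"
  then obtain s where "subst s (Imp (clauses_fm ks) (fact_fm g)) \<in> K4u"
    using assms(1) unfolding unifiable_def by blast
  \<comment> \<open>The substitution is absorbed into the valuation; the valuation and the point are
    arbitrary choices.\<close>
  note K4u_sound[OF this transp_rel[of T], of "\<lambda>_ _. False" Loop, unfolded sat_subst]
  moreover have "sem T v (clauses_fm ks) x" for v x
    using assms(2) unfolding clauses_fm_def by (auto simp: sem_conjs intro!: sem_clause)
  moreover have "\<not> sem T v (fact_fm g) x" for v x
    using sem_atom[of "map num g" T v x] assms(3,4) by (simp add: fact_fm_def comp_def)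
  ultimately show False by simp
qed

section \<open>Horn clauses for recursive functions\<close>

text \<open>Facts refer to functions by number.\<close>

instance recf :: countable
  by countable_datatype

inductive_cases reval_cases:
  "reval Zero xs z" "reval Succ xs z" "reval (Proj i) xs z" "reval (Comp f gs) xs z"
  "reval (Prim f g) (0 # xs) z" "reval (Prim f g) (Suc n # xs) z" "reval (Mn f) xs z"

text \<open>In the case of minimisation, if two results differed, the function would take both zero
  and a nonzero value at the smaller one.\<close>

lemma reval_deterministic: "reval f xs z \<Longrightarrow> reval f xs z' \<Longrightarrow> z = z'"
proof (induction arbitrary: z' rule: reval.induct)
  case (4 xs gs ys f z)
  from 4(4) obtain ys' where ys': "list_all2 (\<lambda>g y. reval g xs y) gs ys'" "reval f ys' z'"
    by (auto elim: reval_cases(4))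
  with 4(1) have "ys = ys'"
    by (intro nth_equalityI) (auto simp: list_all2_conv_all_nth)
  then show ?case using 4(2) ys'(2) by simp
next
  case (7 f n xs)
  from 7(4) have z': "reval f (z' # xs) 0" "\<forall>m<z'. \<exists>y. y \<noteq> 0 \<and> reval f (m # xs) y"
    by (auto elim: reval_cases(7))
  have "\<not> z' < n" using 7(3) z'(1) by blast
  moreover have "\<not> n < z'" using 7(2) z'(2) by blast
  ultimately show ?case by simp
next
  case (6 f g n xs r z)
  from 6(5) obtain r' where "reval (Prim f g) (n # xs) r'" "reval g (n # r' # xs) z'"
    by (auto elim: reval_cases(6))
  then show ?case using 6(3,4) by blast
qed (blast elim: reval_cases(1,2,3,5))+

definition tagged :: "(nat \<Rightarrow> 'a) \<Rightarrow> nat \<Rightarrow> recf \<Rightarrow> 'a list \<Rightarrow> 'a \<Rightarrow> 'a list" where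
  "tagged c k f as t = c k # c (to_nat f) # c (length as) # as @ [t]"

text \<open>The first entry of a fact is its kind: \<open>0\<close> input, \<open>1\<close> halting, \<open>2\<close> being a number (only there to make
  clauses range restricted), \<open>3\<close> the graph of a function, \<open>4\<close> "the function is defined and nonzero
  at all arguments below the last entry".\<close>

abbreviation "ground \<equiv> tagged (\<lambda>n. n)"
abbreviation "val \<equiv> tagged num 3"
abbreviation "pre \<equiv> tagged num 4"
abbreviation "isnat t \<equiv> [num 2, t]"

definition vs :: "nat \<Rightarrow> tm list" where
  "vs k = map V [0..<k]"

text \<open>Clauses at a fixed arity mirror the evaluation rules; subprograms are added at the
  arities at which they are called. \<open>isnat\<close> premises bind argument variables, and
  \<open>S (V (k + 1))\<close> in the clauses for \<open>Mn\<close> matches exactly the nonzero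
  values.\<close>

fun prog :: "recf \<Rightarrow> nat \<Rightarrow> clause list" where
  "prog Zero k = [(map isnat (vs k), val Zero (vs k) Z)]"
| "prog Succ k = (if k = 0 then [] else [(map isnat (vs k), val Succ (vs k) (S (V 0)))])"
| "prog (Proj i) k = (if i < k then [(map isnat (vs k), val (Proj i) (vs k) (V i))] else [])"
| "prog (Comp f gs) k =
     (map isnat (vs k) @ map (\<lambda>i. val (gs ! i) (vs k) (V (k + i))) [0..<length gs]
        @ [val f (map V [k..<k + length gs]) (V (k + length gs))],
      val (Comp f gs) (vs k) (V (k + length gs)))
     # prog f (length gs) @ concat (map (\<lambda>g. prog g k) gs)"
| "prog (Prim f g) 0 = []"
| "prog (Prim f g) (Suc k) =
     ([val f (vs k) (V k)], val (Prim f g) (Z # vs k) (V k))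
     # ([val (Prim f g) (V k # vs k) (V (k + 1)), val g (V k # V (k + 1) # vs k) (V (k + 2))],
        val (Prim f g) (S (V k) # vs k) (V (k + 2)))
     # prog f k @ prog g (Suc (Suc k))"
| "prog (Mn f) k =
     (map isnat (vs k), pre f (vs k) Z)
     # ([pre f (vs k) (V k), val f (V k # vs k) (S (V (k + 1)))], pre f (vs k) (S (V k)))
     # ([pre f (vs k) (V k), val f (V k # vs k) Z], val (Mn f) (vs k) (V k))
     # prog f (Suc k)"

definition base_clauses :: "clause list" where
  "base_clauses = [([], isnat Z), ([isnat (V 0)], isnat (S (V 0)))]"

section \<open>Evaluations are derivable\<close>

lemma map_tagged [simp]:
  "map (eval e) (tagged num k f as t) = ground k f (map (eval e) as) (eval e t)"
  by (simp add: tagged_def)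

lemma length_vs [simp]: "length (vs k) = k"
  by (simp add: vs_def)

lemma eval_vs: "map (eval e) (vs k) = map e [0..<k]"
  by (simp add: vs_def)

lemma map_nth_append [simp]: "map ((!) (xs @ ys)) [0..<length xs] = xs"
  by (rule nth_equalityI) (auto simp: nth_append)

lemma derivable_step:
  "(ps, c) \<in> K \<Longrightarrow> (\<And>p. p \<in> set ps \<Longrightarrow> derivable K (map (eval e) p)) \<Longrightarrow>
   w = map (eval e) c \<Longrightarrow> derivable K w"
  by (auto intro: derivable.step)

lemma derivable_isnat:
  assumes "set base_clauses \<subseteq> K"
  shows "derivable K [2, n]"
proof (induction n)
  case 0
  show ?case
    by (rule derivable_step[of "[]" "isnat Z" K "\<lambda>_. 0"]) (use assms in \<open>auto simp: base_clauses_def\<close>)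
next
  case (Suc n)
  show ?case
    by (rule derivable_step[of "[isnat (V 0)]" "isnat (S (V 0))" K "\<lambda>_. n"])
       (use assms Suc in \<open>auto simp: base_clauses_def\<close>)
qed

lemma derivable_isnats:
  assumes "set base_clauses \<subseteq> K" and "(map isnat (vs k), c) \<in> K"
  shows "derivable K (map (eval e) c)"
  by (rule derivable_step[OF assms(2) _ refl]) (auto simp: vs_def derivable_isnat[OF assms(1)])

text \<open>\<open>K\<close> may be any larger set, so the induction hypotheses apply to subprograms
  inside the full program.\<close>

lemma reval_derivable:
  assumes "reval f xs z" and "set base_clauses \<subseteq> K" and "set (prog f (length xs)) \<subseteq> K"
  shows "derivable K (ground 3 f xs z)"
  using assms(1,3)
proof induction
  case (1 xs)
  then show ?case
    \<comment> \<open>Variable \<open>i\<close> is read as entry \<open>i\<close> of a list; the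
      trailing \<open>[]\<close> gives the list the shape that \<open>map_nth_append\<close>
      rewrites.\<close>
    using derivable_isnats[OF assms(2), of "length xs" "val Zero (vs (length xs)) Z" "(!) (xs @ [])"]
    by (simp only: map_tagged eval_vs map_nth_append eval.simps) simp
next
  case (2 x xs)
  then show ?case
    using derivable_isnats[OF assms(2), of "length (x # xs)" "val Succ (vs (length (x # xs))) (S (V 0))"
        "(!) ((x # xs) @ [])"]
    by (simp only: map_tagged eval_vs map_nth_append eval.simps) simp
next
  case (3 i xs)
  then show ?case
    using derivable_isnats[OF assms(2), of "length xs" "val (Proj i) (vs (length xs)) (V i)"
        "(!) (xs @ [])"]
    by (simp only: map_tagged eval_vs map_nth_append eval.simps) simp
next
  case (4 xs gs ys f z)
  then have len: "length ys = length gs" by (simp add: list_all2_lengthD)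
  \<comment> \<open>The variables stand for the arguments, then the intermediate values, then the
    result.\<close>
  let ?k = "length xs" let ?e = "(!) (xs @ ys @ [z])"
  have ys: "map ?e [?k..<?k + length gs] = ys"
    by (rule nth_equalityI) (auto simp: nth_append len)
  have z: "?e (?k + length gs) = z" by (simp add: nth_append len)
  have f: "derivable K (ground 3 f ys z)" using 4(2,4) len by simp
  have g: "derivable K (ground 3 (gs ! i) xs (ys ! i))" if "i < length gs" for i
  proof -
    have "\<forall>g\<in>set gs. set (prog g ?k) \<subseteq> K" using 4(4) by (simp add: UN_subset_iff)
    with that have "set (prog (gs ! i) ?k) \<subseteq> K" by simp
    with 4(1) that show ?thesis by (simp add: list_all2_conv_all_nth)
  qed
  show ?case
  proof (rule derivable_step[of _ "val (Comp f gs) (vs ?k) (V (?k + length gs))" K ?e])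
    show "(map isnat (vs ?k) @ map (\<lambda>i. val (gs ! i) (vs ?k) (V (?k + i))) [0..<length gs]
        @ [val f (map V [?k..<?k + length gs]) (V (?k + length gs))],
        val (Comp f gs) (vs ?k) (V (?k + length gs))) \<in> K"
      using 4(4) by simp
    show "derivable K (map (eval ?e) p)" if "p \<in> set (map isnat (vs ?k) @
        map (\<lambda>i. val (gs ! i) (vs ?k) (V (?k + i))) [0..<length gs]
        @ [val f (map V [?k..<?k + length gs]) (V (?k + length gs))])" for p
    proof -
      from that consider t where "p = isnat t" 
        | i where "i < length gs" "p = val (gs ! i) (vs ?k) (V (?k + i))"
        | "p = val f (map V [?k..<?k + length gs]) (V (?k + length gs))"
        by auto
      then show ?thesis
      proof cases
        case 1
        then show ?thesis using derivable_isnat[OF assms(2)] by simp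
      next
        case 2
        then show ?thesis using g[of i] len by (simp add: eval_vs nth_append)
      next
        case 3
        have "map (eval ?e) (map V [?k..<?k + length gs]) = ys"
          using ys by (simp add: comp_def)
        with 3 f z show ?thesis by simp
      qed
    qed
    show "ground 3 (Comp f gs) xs z = map (eval ?e) (val (Comp f gs) (vs ?k) (V (?k + length gs)))"
      using z by (simp add: eval_vs)
  qed
next
  case (5 f xs z g)
  let ?k = "length xs"
  have K: "([val f (vs ?k) (V ?k)], val (Prim f g) (Z # vs ?k) (V ?k)) \<in> K"
    and f: "derivable K (ground 3 f xs z)"
    using 5(2,3) by simp_all
  show ?case
    by (rule derivable_step[OF K, of "(!) (xs @ [z])"]) (use f in \<open>simp_all add: eval_vs\<close>)
next
  case (6 f g n xs r z)
  let ?k = "length xs"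
  have K: "([val (Prim f g) (V ?k # vs ?k) (V (?k + 1)), val g (V ?k # V (?k + 1) # vs ?k) (V (?k + 2))],
      val (Prim f g) (S (V ?k) # vs ?k) (V (?k + 2))) \<in> K"
    and f: "derivable K (ground 3 (Prim f g) (n # xs) r)"
    and g: "derivable K (ground 3 g (n # r # xs) z)"
    using 6(3,4,5) by simp_all
  show ?case
    by (rule derivable_step[OF K, of "(!) (xs @ [n, r, z])"])
       (use f g in \<open>auto simp: eval_vs nth_append\<close>)
next
  case (7 f n xs)
  let ?k = "length xs"
  have K: "(map isnat (vs ?k), pre f (vs ?k) Z) \<in> K"
    "([pre f (vs ?k) (V ?k), val f (V ?k # vs ?k) (S (V (?k + 1)))], pre f (vs ?k) (S (V ?k))) \<in> K"
    "([pre f (vs ?k) (V ?k), val f (V ?k # vs ?k) Z], val (Mn f) (vs ?k) (V ?k)) \<in> K"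
    and p: "set (prog f (Suc ?k)) \<subseteq> K"
    using 7(4) by simp_all
  \<comment> \<open>The facts of kind \<open>4\<close> are derived one argument at a time, up to the
    search result \<open>n\<close>.\<close>
  have "derivable K (ground 4 f xs m)" if "m \<le> n" for m
    using that
  proof (induction m)
    case 0
    show ?case
      using derivable_isnats[OF assms(2) K(1), of "(!) (xs @ [])"]
      by (simp only: map_tagged eval_vs map_nth_append eval.simps)
  next
    case (Suc m)
    then have m: "derivable K (ground 4 f xs m)" by simp
    obtain y where "y \<noteq> 0" and y: "derivable K (ground 3 f (m # xs) y)"
      using 7(3) p Suc.prems by (auto simp: Suc_le_eq)
    then obtain y' where y': "y = Suc y'" by (cases y) auto
    show ?case
      by (rule derivable_step[OF K(2), of "(!) (xs @ [m, y'])"])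
         (use m y y' in \<open>auto simp: eval_vs nth_append\<close>)
  qed
  then have n: "derivable K (ground 4 f xs n)" by simp
  have f: "derivable K (ground 3 f (n # xs) 0)" using 7(2) p by simp
  show ?case
    by (rule derivable_step[OF K(3), of "(!) (xs @ [n])"])
       (use n f in \<open>auto simp: eval_vs nth_append\<close>)
qed

text \<open>The intended model for input \<open>n\<close>. As it contains no halting fact, it is
  closed under a halting clause exactly when the simulated function diverges on
  \<open>n\<close>.\<close>

definition true_facts :: "nat \<Rightarrow> nat list set" where
  "true_facts n = {[0, n]} \<union> {[2, m] |m. True} \<union> {ground 3 f xs z |f xs z. reval f xs z}
     \<union> {ground 4 f xs m |f xs m. \<forall>i<m. \<exists>y. y \<noteq> 0 \<and> reval f (i # xs) y}"

text \<open>The stored argument length excludes proper prefixes, so prefix matching becomes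
  equality.\<close>

lemma matches_tagged:
  "matches (ground k f xs z) (ground k' f' xs' z') \<longleftrightarrow> k = k' \<and> f = f' \<and> xs = xs' \<and> z = z'"
proof
  assume m: "matches (ground k f xs z) (ground k' f' xs' z')"
  then have k: "k = k'" and f: "f = f'" and len: "length xs = length xs'"
    by (simp_all add: matches_def tagged_def)
  from m have "xs @ [z] = take (Suc (length xs)) (xs' @ [z'])"
    by (simp add: matches_def tagged_def del: take_append)
  also have "\<dots> = xs' @ [z']" using len by simp
  finally show "k = k' \<and> f = f' \<and> xs = xs' \<and> z = z'" using k f by simp
qed (simp add: matches_def)

lemma matches_simps [simp]:
  "a \<noteq> k \<Longrightarrow> \<not> matches [a, b] (ground k f xs z)"
  "\<not> matches (ground k f xs z) [a, b]"
  "matches [a, b] [c, d] \<longleftrightarrow> a = c \<and> b = d"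
  "matches [a] (ground k f xs z) \<longleftrightarrow> a = k"
  "matches [a] [c, d] \<longleftrightarrow> a = c"
  by (auto simp: matches_def tagged_def)

lemma true_facts_match:
  "(\<exists>w\<in>true_facts n. matches (ground 3 f xs z) w) \<longleftrightarrow> reval f xs z" (is ?a)
  "(\<exists>w\<in>true_facts n. matches (ground 4 f xs m) w) \<longleftrightarrow> (\<forall>i<m. \<exists>y. y \<noteq> 0 \<and> reval f (i # xs) y)" (is ?b)
  "\<exists>w\<in>true_facts n. matches [2, m] w" (is ?c)
  "(\<exists>w\<in>true_facts n. matches [0, m] w) \<longleftrightarrow> m = n" (is ?d)
  "\<not> (\<exists>w\<in>true_facts n. matches [1] w)" (is ?e)
proof -
  have *: "(\<exists>w\<in>{h x y z |x y z. A x y z}. B w) \<longleftrightarrow> (\<exists>x y z. A x y z \<and> B (h x y z))"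
    for h :: "recf \<Rightarrow> nat list \<Rightarrow> nat \<Rightarrow> nat list" and A B by blast
  have **: "(\<exists>w\<in>{h x |x. True}. B w) \<longleftrightarrow> (\<exists>x. B (h x))" for h :: "nat \<Rightarrow> nat list" and B by blast
  show ?a ?b ?c ?d ?e
    unfolding true_facts_def bex_Un * ** by (simp_all add: matches_tagged)
qed

lemma vars_num [simp]: "vars (num n) = {}"
  by (induction n) auto

lemma vars_tagged [simp]: "\<Union>(vars ` set (tagged num k f as t)) = \<Union>(vars ` set as) \<union> vars t"
  by (auto simp: tagged_def)

definition sound_clause :: "nat list set \<Rightarrow> clause \<Rightarrow> bool" where
  "sound_clause T k \<longleftrightarrow>
     range_restricted k \<and> closed_under T k \<and> (\<forall>p\<in>insert (snd k) (set (fst k)). p \<noteq> [])"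

lemma tagged_nonempty [simp]: "tagged c k f as t \<noteq> []" "[] \<noteq> tagged c k f as t"
  by (simp_all add: tagged_def)

lemma vars_vs [simp]: "\<Union>(vars ` set (vs k)) = {..<k}" "(\<Union>p\<in>set (vs k). vars p) = {..<k}"
  by (auto simp: vs_def)

text \<open>Clauses with a \<open>val\<close> conclusion follow the introduction rules of
  \<open>reval\<close>; those with a \<open>pre\<close> conclusion start or extend an initial
  segment of arguments with nonzero values.\<close>

lemma prog_sound: "k \<in> set (prog f a) \<Longrightarrow> sound_clause (true_facts n) k"
proof (induction f a rule: prog.induct)
  case (4 f gs a)
  let ?k = "(map isnat (vs a) @ map (\<lambda>i. val (gs ! i) (vs a) (V (a + i))) [0..<length gs]
        @ [val f (map V [a..<a + length gs]) (V (a + length gs))],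
      val (Comp f gs) (vs a) (V (a + length gs)))"
  have "closed_under (true_facts n) ?k"
    unfolding closed_under_def
  proof (intro allI impI)
    fix e assume *: "\<forall>p\<in>set (fst ?k). \<exists>w\<in>true_facts n. matches (map (eval e) p) w"
    let ?xs = "map e [0..<a]" and ?ys = "map e [a..<a + length gs]" and ?z = "e (a + length gs)"
    have "list_all2 (\<lambda>g y. reval g ?xs y) gs ?ys"
      using * by (simp add: ball_Un true_facts_match comp_def list_all2_conv_all_nth eval_vs)
    moreover have "reval f ?ys ?z"
      using * by (simp add: ball_Un true_facts_match comp_def)
    ultimately have "reval (Comp f gs) ?xs ?z" by (rule reval.intros)
    then show "\<exists>w\<in>true_facts n. matches (map (eval e) (snd ?k)) w"
      by (simp add: true_facts_match eval_vs)
  qed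
  moreover have "range_restricted ?k"
    by (auto simp: range_restricted_def)
  ultimately have "sound_clause (true_facts n) ?k"
    by (auto simp: sound_clause_def)
  moreover have "k = ?k \<or> k \<in> set (prog f (length gs)) \<or> (\<exists>g\<in>set gs. k \<in> set (prog g a))"
    using 4(3) by simp
  ultimately show ?case using 4(1,2) by blast
next
  case (6 f g a)
  let ?k = "([val f (vs a) (V a)], val (Prim f g) (Z # vs a) (V a))"
  let ?k' = "([val (Prim f g) (V a # vs a) (V (a + 1)), val g (V a # V (a + 1) # vs a) (V (a + 2))],
      val (Prim f g) (S (V a) # vs a) (V (a + 2)))"
  have "sound_clause (true_facts n) ?k"
    by (auto simp: sound_clause_def range_restricted_def closed_under_def true_facts_match
        intro: reval.intros(5))
  moreover have "sound_clause (true_facts n) ?k'"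
    by (auto simp: sound_clause_def range_restricted_def closed_under_def true_facts_match
        intro: reval.intros(6))
  moreover have "k = ?k \<or> k = ?k' \<or> k \<in> set (prog f a) \<or> k \<in> set (prog g (Suc (Suc a)))"
    using 6(3) by simp
  ultimately show ?case using 6(1,2) by blast
next
  case (7 f a)
  let ?k = "(map isnat (vs a), pre f (vs a) Z)"
  let ?k' = "([pre f (vs a) (V a), val f (V a # vs a) (S (V (a + 1)))], pre f (vs a) (S (V a)))"
  let ?k'' = "([pre f (vs a) (V a), val f (V a # vs a) Z], val (Mn f) (vs a) (V a))"
  have "sound_clause (true_facts n) ?k"
    by (auto simp: sound_clause_def range_restricted_def closed_under_def true_facts_match)
  moreover have "sound_clause (true_facts n) ?k'"
    by (fastforce simp: sound_clause_def range_restricted_def closed_under_def true_facts_match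
        less_Suc_eq)
  moreover have "sound_clause (true_facts n) ?k''"
    by (auto simp: sound_clause_def range_restricted_def closed_under_def true_facts_match
        intro: reval.intros(7))
  moreover have "k = ?k \<or> k = ?k' \<or> k = ?k'' \<or> k \<in> set (prog f (Suc a))"
    using 7(2) by simp
  ultimately show ?case using 7(1) by blast
next
  case (1 a)
  have "sound_clause (true_facts n) (map isnat (vs a), val Zero (vs a) Z)"
    by (auto simp: sound_clause_def range_restricted_def closed_under_def true_facts_match
        intro: reval.intros(1))
  with 1 show ?case by simp
next
  case (2 a)
  have "sound_clause (true_facts n) (map isnat (vs a), val Succ (vs a) (S (V 0)))" if "0 < a"
  proof -
    have "vs a = V 0 # map V [1..<a]" using that by (simp add: vs_def upt_conv_Cons)
    then show ?thesis
      by (auto simp: sound_clause_def range_restricted_def closed_under_def true_facts_match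
          intro: reval.intros(2))
  qed
  with 2 show ?case by (simp split: if_splits)
next
  case (3 i a)
  have "sound_clause (true_facts n) (map isnat (vs a), val (Proj i) (vs a) (V i))" if "i < a"
    using that reval.intros(3)[of i "map _ [0..<a]"]
    by (auto simp: sound_clause_def range_restricted_def closed_under_def true_facts_match eval_vs)
  with 3 show ?case by (simp split: if_splits)
qed simp

section \<open>Halting as a unification problem\<close>

definition halt_clause :: "recf \<Rightarrow> clause" where
  "halt_clause f = ([[num 0, V 0], val f [V 0] (V 1)], [num 1])"

definition input_clause :: "nat \<Rightarrow> clause" where
  "input_clause n = ([], [num 0, num n])"

definition machine :: "recf \<Rightarrow> clause list" where
  "machine f = halt_clause f # base_clauses @ prog f 1"

text \<open>The formula depends on the input only through its second conjunct, so that its code is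
  computable from the code of \<open>machine_fm f\<close> and the input.\<close>

definition machine_fm :: "recf \<Rightarrow> fm" where
  "machine_fm f = Conj (clauses_fm (machine f)) (Neg (fact_fm [1]))"

definition halting_fm :: "recf \<Rightarrow> nat \<Rightarrow> fm" where
  "halting_fm f n = Neg (Conj (machine_fm f) (clause_fm (input_clause n)))"

lemma halts_derivable:
  assumes "reval f [n] z"
  shows "derivable (set (input_clause n # machine f)) [1]" (is "derivable ?K _")
proof -
  have "derivable ?K (ground 3 f [n] z)"
    using assms by (rule reval_derivable) (auto simp: machine_def)
  moreover have "derivable ?K [0, n]"
    by (rule derivable_step[of "[]" "[num 0, num n]" _ "\<lambda>_. 0"]) (auto simp: input_clause_def)
  moreover have "([[num 0, V 0], val f [V 0] (V 1)], [num 1]) \<in> ?K"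
    by (simp add: machine_def halt_clause_def)
  ultimately show ?thesis
    by (elim derivable_step[where e = "(!) [n, z]"]) auto
qed

lemma machine_sound:
  assumes "\<And>z. \<not> reval f [n] z" and "k \<in> set (input_clause n # machine f)"
  shows "sound_clause (true_facts n) k"
proof -
  have "sound_clause (true_facts n) k" if "k \<in> set (input_clause n # halt_clause f # base_clauses)"
    using that assms(1)
    by (auto simp: true_facts_match input_clause_def halt_clause_def base_clauses_def sound_clause_def
        range_restricted_def closed_under_def)
  moreover have "k \<in> set (input_clause n # halt_clause f # base_clauses) \<or> k \<in> set (prog f 1)"
    using assms(2) by (auto simp: machine_def)
  ultimately show ?thesis using prog_sound by blast
qed

text \<open>Lets the conjuncts of \<open>halting_fm\<close> be regrouped into an implication from
  the clauses to the goal.\<close>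

lemma (in normal_logic) unifiable_cong:
  assumes "\<And>s v. peval v (subst s a) \<longleftrightarrow> peval v (subst s b)"
  shows "unifiable L a \<longleftrightarrow> unifiable L b"
proof -
  have "subst s a \<in> L \<longleftrightarrow> subst s b \<in> L" for s
    using assms taut_mp[of "subst s a" "subst s b"] taut_mp[of "subst s b" "subst s a"]
    by (auto simp: taut_def)
  then show ?thesis by (simp add: unifiable_def)
qed

theorem halting_unifiable:
  assumes "normal_u L" and "L \<subseteq> K4u"
  shows "unifiable L (halting_fm f n) \<longleftrightarrow> (\<exists>z. reval f [n] z)"
proof -
  interpret normal_logic L by unfold_locales fact
  let ?ks = "input_clause n # machine f"
  have "unifiable L (halting_fm f n) \<longleftrightarrow> unifiable L (Imp (clauses_fm ?ks) (fact_fm [1]))"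
    by (rule unifiable_cong)
       (auto simp: halting_fm_def machine_fm_def clauses_fm_def subst_defs)
  also have "\<dots> \<longleftrightarrow> (\<exists>z. reval f [n] z)"
  proof
    assume "\<exists>z. reval f [n] z"
    then show "unifiable L (Imp (clauses_fm ?ks) (fact_fm [1]))"
      using halts_derivable derivable_unifiable by blast
  next
    show "\<exists>z. reval f [n] z" if "unifiable L (Imp (clauses_fm ?ks) (fact_fm [1]))"
    proof (rule ccontr)
      assume "\<not> (\<exists>z. reval f [n] z)"
      then have "\<forall>k\<in>set ?ks. sound_clause (true_facts n) k" using machine_sound by blast
      then have "\<not> unifiable L (Imp (clauses_fm ?ks) (fact_fm [1]))"
        using true_facts_match(5)
        by (intro not_unifiable[OF assms(2), of _ "true_facts n"]) (auto simp: sound_clause_def)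
      with that show False by simp
    qed
  qed
  finally show ?thesis .
qed

section \<open>Computability of the reduction\<close>

text \<open>The parameter \<open>e\<close> encodes the inputs: \<open>code\<close> for formulas, the
  identity for numbers.\<close>

definition computable :: "('i \<Rightarrow> nat) \<Rightarrow> ('i \<Rightarrow> nat) \<Rightarrow> bool" where
  "computable e f \<longleftrightarrow> (\<exists>r. \<forall>i. reval r [e i] (f i))"

lemma reval_Comp1: "reval g xs y \<Longrightarrow> reval f [y] z \<Longrightarrow> reval (Comp f [g]) xs z"
  by (rule reval.intros(4)[of _ _ "[y]"]) auto

lemma reval_Comp2:
  "reval g xs y \<Longrightarrow> reval h xs y' \<Longrightarrow> reval f [y, y'] z \<Longrightarrow> reval (Comp f [g, h]) xs z"
  by (rule reval.intros(4)[of _ _ "[y, y']"]) auto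

lemma reval_Proj: "i < length xs \<Longrightarrow> y = xs ! i \<Longrightarrow> reval (Proj i) xs y"
  by (auto intro: reval.intros)

primrec const_rec :: "nat \<Rightarrow> recf" where
  "const_rec 0 = Zero"
| "const_rec (Suc n) = Comp Succ [const_rec n]"

lemma reval_const: "reval (const_rec n) xs n"
  by (induction n) (auto intro: reval.intros reval_Comp1)

definition "add_rec = Prim (Proj 0) (Comp Succ [Proj 1])"

lemma reval_add: "reval add_rec [m, n] (m + n)"
proof (induction m)
  case 0
  show ?case unfolding add_rec_def by (intro reval.intros(5)) (simp add: reval_Proj)
next
  case (Suc m)
  have "reval (Comp Succ [Proj 1]) [m, m + n, n] (Suc (m + n))"
    by (intro reval_Comp1[of _ _ "m + n"] reval_Proj reval.intros(2)) auto
  with Suc show ?case unfolding add_rec_def by (auto intro: reval.intros(6))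
qed

definition "triangle_rec = Prim Zero (Comp add_rec [Proj 1, Comp Succ [Proj 0]])"

lemma reval_triangle: "reval triangle_rec [n] (triangle n)"
proof (induction n)
  case 0
  show ?case unfolding triangle_rec_def by (simp add: reval.intros(1,5))
next
  case (Suc n)
  have "reval (Comp add_rec [Proj 1, Comp Succ [Proj 0]]) [n, triangle n] (triangle n + Suc n)"
    by (intro reval_Comp2[of _ _ "triangle n" _ "Suc n"] reval_Comp1[of _ _ n] reval_add
        reval_Proj reval.intros(2)) auto
  then show ?case
    using Suc unfolding triangle_rec_def by (auto intro: reval.intros(6))
qed

definition "pair_rec = Comp add_rec [Comp triangle_rec [add_rec], Proj 0]"

text \<open>Cantor pairing, on which \<open>code\<close> is built, is
  \<open>triangle (m + n) + m\<close>.\<close>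

lemma reval_pair: "reval pair_rec [m, n] (prod_encode (m, n))"
  unfolding pair_rec_def prod_encode_def
  by (simp, intro reval_Comp2[of _ _ "triangle (m + n)" _ m] reval_Comp1[of _ _ "m + n"]
      reval_add reval_triangle reval_Proj) auto

lemma computable_const: "computable e (\<lambda>_. n)"
  unfolding computable_def using reval_const by blast

lemma computable_self: "computable e e"
  unfolding computable_def by (rule exI[of _ "Proj 0"]) (auto intro: reval_Proj)

lemma computable_pair:
  "computable e f \<Longrightarrow> computable e g \<Longrightarrow> computable e (\<lambda>i. prod_encode (f i, g i))"
  unfolding computable_def by (blast intro: reval_Comp2 reval_pair)

lemmas computable_intros = computable_const computable_self computable_pair

lemma computable_comp:
  assumes "computable code (\<lambda>a. code (F a))" and "computable e (\<lambda>i. code (a i))"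
  shows "computable e (\<lambda>i. code (F (a i)))"
  using assms unfolding computable_def by (blast intro: reval_Comp1)

lemma computable_suc_fm: "computable code (\<lambda>a. code (suc_fm a))"
  unfolding suc_fm_def Dia_def code.simps by (intro computable_intros)

lemma computable_entry: "computable code (\<lambda>a. code (entry j a))"
  unfolding entry_def Dia_def code.simps by (intro computable_intros computable_suc_fm)

text \<open>Primitive recursion on \<open>n\<close> iterates the effect of \<open>suc_fm\<close> on
  codes.\<close>

lemma computable_num: "computable (\<lambda>n. n) (\<lambda>n. code (tm_fm (num n)))"
proof -
  obtain r where r: "\<And>a. reval r [code a] (code (suc_fm a))"
    using computable_suc_fm unfolding computable_def by blast
  have "reval (Prim (const_rec (code zero_fm)) (Comp r [Proj 1])) [n] (code (tm_fm (num n)))" for n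
  proof (induction n)
    case 0
    show ?case using reval_const[of "code zero_fm" "[]"] by (simp add: reval.intros(5))
  next
    case (Suc n)
    have "reval (Comp r [Proj 1]) [n, code (tm_fm (num n))] (code (tm_fm (num (Suc n))))"
      by (rule reval_Comp1[OF reval_Proj]) (auto simp: r)
    with Suc show ?case by (rule reval.intros(6))
  qed
  then show ?thesis unfolding computable_def by blast
qed

lemma computable_input: "computable (\<lambda>n. n) (\<lambda>n. code (clause_fm (input_clause n)))"
  unfolding input_clause_def clause_fm_def atom_fm_def Imp_def Ex_def Dia_def
    fst_conv snd_conv list.map entries.simps code.simps
  by (intro computable_intros computable_comp[OF computable_entry] computable_num)

lemma inj_code: "inj code"
proof (rule injI)
  show "code a = code b \<Longrightarrow> a = b" for a b
    by (induction a arbitrary: b; case_tac b) (auto simp: prod_encode_eq)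
qed

theorem theorem1:
  fixes L :: "fm set"
  assumes "normal_u L" and "Ku \<subseteq> L" and "L \<subseteq> K4u"
  shows "\<not> decidable_fm {a. unifiable L a}"
proof
  assume "decidable_fm {a. unifiable L a}"
  then obtain d where d: "\<And>a. reval d [code a] (if unifiable L a then 1 else 0)"
    unfolding decidable_fm_def decidable_def
    by (metis inj_image_mem_iff[OF inj_code] mem_Collect_eq)
  \<comment> \<open>The tags \<open>1\<close> and \<open>2\<close> code negation and conjunction:
    this is the code of \<open>halting_fm f n\<close> when \<open>n\<close> is the code of
    \<open>machine_fm f\<close>.\<close>
  have "computable (\<lambda>n. n) (\<lambda>n. prod_encode (1, prod_encode (2,
      prod_encode (n, code (clause_fm (input_clause n))))))"
    by (intro computable_intros computable_input)
  then obtain h where h: "\<And>n. reval h [n] (prod_encode (1, prod_encode (2,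
      prod_encode (n, code (clause_fm (input_clause n))))))"
    unfolding computable_def by blast
  \<comment> \<open>\<open>Proj 1\<close> drops the search argument, so \<open>Mn g\<close> stops at
    \<open>0\<close> if \<open>d\<close> answers \<open>0\<close> and diverges if it answers
    \<open>1\<close>.\<close>
  define g where "g = Comp d [Comp h [Proj 1]]"
  \<comment> \<open>\<open>Mn g\<close> halts on the code \<open>n\<close> of its own formula iff \<open>halting_fm (Mn g) n\<close> is not unifiable.\<close>
  define n where "n = code (machine_fm (Mn g))"
  have "reval h [n] (code (halting_fm (Mn g) n))"
    using h[of n] by (simp add: n_def halting_fm_def)
  with d have g: "reval g [m, n] (if unifiable L (halting_fm (Mn g) n) then 1 else 0)" for m
    unfolding g_def by (intro reval_Comp1[of _ _ "code (halting_fm (Mn g) n)"] 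
        reval_Comp1[of _ _ n] reval_Proj) (auto simp: g_def)
  have "(\<exists>z. reval (Mn g) [n] z) \<longleftrightarrow> \<not> unifiable L (halting_fm (Mn g) n)"
  proof
    assume "\<exists>z. reval (Mn g) [n] z"
    then obtain z where "reval g [z, n] 0" by (auto elim: reval_cases)
    with g[of z] show "\<not> unifiable L (halting_fm (Mn g) n)"
      by (auto dest: reval_deterministic)
  next
    assume "\<not> unifiable L (halting_fm (Mn g) n)"
    then show "\<exists>z. reval (Mn g) [n] z"
      using g[of 0] by (auto intro: reval.intros(7)[of g 0])
  qed
  with halting_unifiable[OF assms(1,3)] show False by blast
qed

end
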